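(* Let $n$ and $\ell$ be integers satisfying $n/2<\ell<n$. Each zero-free sequence of length $\ell$ in $\mathbb{Z}_n$ has a term with multiplicity: a) at least $2\ell-n+1$ if $(2n-2)/3\le\ell<n$; b) at least $\ell-\lfloor (n-1)/3\rfloor$ if $n/2<\ell\le(2n-2)/3$. These estimates are best possible: for all integers $n,\ell$ in the respective range there is a zero-free sequence of length $\ell$ in $\mathbb{Z}_n$ in which the maximum multiplicity of a term equals the stated bound.
   Context: $\mathbb{Z}_n=\mathbb{Z}/n\mathbb{Z}$ is the additive group of integers modulo $n$. Sequences are finite, and terms may repeat; the multiplicity of a term is the number of its occurrences in the sequence. A sequence in $\mathbb{Z}_n$ is zero-free if no nonempty subsequence of it has sum equal to the zero element of $\mathbb{Z}_n$ (a subsequence is obtained by choosing a set of indices). $\lfloor x\rfloor$ denotes the greatest integer not exceeding $x$. *)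

theory Defs
  imports Complex_Main "HOL-Algebra.Elementary_Groups" "HOL-Algebra.FiniteProduct"
begin

text \<open>
  Sequences are lists, subsequences are given by sets of indices. The group is written
  multiplicatively as in the library, so its additive zero is \<open>\<one>\<^bsub>G\<^esub>\<close>
  and the sum of a subsequence is \<open>finprod\<close>.
\<close>

definition zero_free :: "('a, 'b) monoid_scheme \<Rightarrow> 'a list \<Rightarrow> bool" where
  "zero_free G xs \<longleftrightarrow>
     set xs \<subseteq> carrier G \<and>
     (\<forall>I. I \<subseteq> {..<length xs} \<and> I \<noteq> {} \<longrightarrow> finprod G (\<lambda>i. xs ! i) I \<noteq> \<one>\<^bsub>G\<^esub>)"

text \<open>Only meaningful for nonempty \<open>xs\<close>.\<close>

definition max_multiplicity :: "'a list \<Rightarrow> nat" where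
  "max_multiplicity xs = Max (count_list xs ` set xs)"

end

theory Submission
  imports Defs "HOL-Library.Multiset"
begin

text \<open>
  The bounds follow from a structure theorem: if \<open>n/2 < \<ell>\<close>, then every zero-free sequence of
  length \<open>\<ell>\<close> modulo \<open>n\<close> consists of multiples \<open>k b\<close> of one element \<open>b\<close>, with positive integer
  coefficients \<open>k\<close> whose total is smaller than \<open>n\<close>. Terms with equal coefficients are equal, so
  the multiplicities are at least those in a sequence of \<open>\<ell>\<close> positive integers with total at
  most \<open>n - 1\<close>. In such a sequence with \<open>u\<close> ones and \<open>v\<close> twos the total is at least
  \<open>2 \<ell> - u\<close> and at least \<open>3 \<ell> - 2 u - v\<close>, which gives the two estimates. They are attained by
  sequences of ones, twos and threes with total below \<open>n\<close>, which are zero-free because no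
  subsum reaches \<open>n\<close>.

  The structure theorem (\<open>small_multiples_if_few_subsums\<close>) needs only that the set \<open>S\<close> of all
  subsums, the empty one included, has at most \<open>2 \<ell> - 1\<close> elements; if \<open>n/2 < \<ell>\<close>, this holds as
  there are only \<open>n\<close> residues. The proof is by induction on \<open>\<ell>\<close>. If deleting some term costs at
  least two subsums, then the rest satisfies the induction hypothesis, its subsums form
  the progression \<open>0, b, \<dots>, X b\<close>, and the deleted term must continue this progression, for
  otherwise it would double the number of subsums (\<open>small_multiples_add_mset\<close>). If every deletion
  costs just one subsum, which is then the total sum, a translation argument shows that all
  terms are equal (\<open>all_equal_if_only_total_lost\<close>).
\<close>

section \<open>Subsums modulo n\<close>

definition subsums :: "int \<Rightarrow> int multiset \<Rightarrow> int set" where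
  "subsums n M = {sum_mset A mod n | A. A \<subseteq># M}"

definition zero_sum_free :: "int \<Rightarrow> int multiset \<Rightarrow> bool" where
  "zero_sum_free n M \<longleftrightarrow> (\<forall>A. A \<subseteq># M \<and> A \<noteq> {#} \<longrightarrow> sum_mset A mod n \<noteq> 0)"

lemma zero_sum_freeD:
  "zero_sum_free n M \<Longrightarrow> A \<subseteq># M \<Longrightarrow> A \<noteq> {#} \<Longrightarrow> sum_mset A mod n \<noteq> 0"
  unfolding zero_sum_free_def by simp

lemma zero_sum_free_subset: "zero_sum_free n M \<Longrightarrow> A \<subseteq># M \<Longrightarrow> zero_sum_free n A"
  unfolding zero_sum_free_def by (meson subset_mset.order_trans)

lemma subsums_mono: "A \<subseteq># M \<Longrightarrow> subsums n A \<subseteq> subsums n M"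
  unfolding subsums_def by (auto intro: subset_mset.order_trans)

lemma zero_in_subsums: "0 \<in> subsums n M"
  unfolding subsums_def by (force intro: exI[of _ "{#}"])

lemma subsums_add_mset:
  "subsums n (add_mset a M) = subsums n M \<union> (\<lambda>s. (s + a) mod n) ` subsums n M"
proof (intro equalityI subsetI)
  fix t assume "t \<in> subsums n (add_mset a M)"
  then obtain A where A: "A \<subseteq># add_mset a M" "t = sum_mset A mod n"
    by (auto simp: subsums_def)
  have *: "A - {#a#} \<subseteq># M" using A(1) by (simp add: subset_eq_diff_conv)
  show "t \<in> subsums n M \<union> (\<lambda>s. (s + a) mod n) ` subsums n M"
  proof (cases "a \<in># A")
    case True
    then obtain B where B: "A = add_mset a B" by (meson mset_add)
    then have "t = (sum_mset B mod n + a) mod n"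
      using A(2) by (simp add: mod_simps add.commute)
    moreover have "sum_mset B mod n \<in> subsums n M" using * B by (auto simp: subsums_def)
    ultimately show ?thesis by blast
  next
    case False
    then have "A \<subseteq># M" using * by (simp add: diff_single_trivial)
    then show ?thesis using A(2) by (auto simp: subsums_def)
  qed
next
  fix t assume "t \<in> subsums n M \<union> (\<lambda>s. (s + a) mod n) ` subsums n M"
  then show "t \<in> subsums n (add_mset a M)"
  proof
    assume "t \<in> subsums n M"
    then show ?thesis using subsums_mono[of M "add_mset a M" n] by auto
  next
    assume "t \<in> (\<lambda>s. (s + a) mod n) ` subsums n M"
    then obtain A where A: "A \<subseteq># M" "t = (sum_mset A mod n + a) mod n"
      by (auto simp: subsums_def)
    then have "t = sum_mset (add_mset a A) mod n" by (simp add: mod_simps add.commute)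
    moreover have "add_mset a A \<subseteq># add_mset a M" using A(1) by simp
    ultimately show ?thesis unfolding subsums_def by blast
  qed
qed

lemma finite_subsums [simp]: "finite (subsums n M)"
proof (induction M)
  case empty
  have "subsums n {#} = {0}" by (auto simp: subsums_def)
  then show ?case by simp
qed (simp add: subsums_add_mset)

text \<open>Otherwise the new term would complete that subsum to a zero sum.\<close>

lemma zero_sum_free_add_mset_not_zero:
  assumes "zero_sum_free n (add_mset a M)" "s \<in> subsums n M"
  shows "(s + a) mod n \<noteq> 0"
proof -
  obtain A where A: "A \<subseteq># M" "s = sum_mset A mod n"
    using assms(2) by (auto simp: subsums_def)
  then have "(s + a) mod n = sum_mset (add_mset a A) mod n"
    by (simp add: mod_simps add.commute)
  moreover have "add_mset a A \<subseteq># add_mset a M" using A(1) by simp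
  ultimately show ?thesis
    using zero_sum_freeD[OF assms(1), of "add_mset a A"] by simp
qed

text \<open>If the total sum were attained without \<open>a\<close>, the terms left out would have sum zero.\<close>

lemma total_notin_subsums:
  assumes "zero_sum_free n (add_mset a M)"
  shows "sum_mset (add_mset a M) mod n \<notin> subsums n M"
proof
  assume "sum_mset (add_mset a M) mod n \<in> subsums n M"
  then obtain A where A: "A \<subseteq># M" "sum_mset (add_mset a M) mod n = sum_mset A mod n"
    by (auto simp: subsums_def)
  obtain B where B: "M = A + B" using A(1) by (auto simp: mset_subset_eq_exists_conv)
  have "sum_mset (add_mset a B) mod n = 0"
    using A(2) unfolding B by (simp add: mod_eq_dvd_iff algebra_simps)
  moreover have "add_mset a B \<subseteq># add_mset a M" using B by simp
  ultimately show False using zero_sum_freeD[OF assms, of "add_mset a B"] by simp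
qed

section \<open>Sequences with few subsums\<close>

text \<open>
  The terms are multiples \<open>k b\<close> with positive coefficients \<open>k\<close>, and the subsums are
  the multiples \<open>j b\<close> for \<open>j\<close> up to the total coefficient. The last condition says that
  this total is smaller than the order of \<open>b\<close>, so that these multiples are distinct.
\<close>

definition small_multiples :: "int \<Rightarrow> int multiset \<Rightarrow> int \<Rightarrow> int multiset \<Rightarrow> bool" where
  "small_multiples n M b K \<longleftrightarrow>
     M = image_mset (\<lambda>k. k * b mod n) K \<and> (\<forall>k\<in>#K. 1 \<le> k) \<and>
     subsums n M = (\<lambda>j. j * b mod n) ` {0..sum_mset K} \<and>
     (\<forall>j\<in>{1..sum_mset K}. j * b mod n \<noteq> 0)"

lemma small_multiples_inj_on:
  assumes "\<forall>j\<in>{1..m}. j * b mod n \<noteq> (0::int)"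
  shows "inj_on (\<lambda>j. j * b mod n) {0..m}"
proof -
  have *: "i * b mod n \<noteq> j * b mod n" if "i < j" "0 \<le> i" "j \<le> m" for i j
  proof
    assume "i * b mod n = j * b mod n"
    then have "(j - i) * b mod n = 0" by (metis mod_eq_dvd_iff dvd_imp_mod_0 left_diff_distrib)
    moreover have "j - i \<in> {1..m}" using that by auto
    ultimately show False using bspec[OF assms] by simp
  qed
  show ?thesis
  proof (rule inj_onI)
    fix i j assume "i \<in> {0..m}" "j \<in> {0..m}" "i * b mod n = j * b mod n"
    then show "i = j" using *[of i j] *[of j i] by (cases i j rule: linorder_cases) auto
  qed
qed

lemma sum_mset_nonneg_int: "\<forall>k\<in>#K. (1::int) \<le> k \<Longrightarrow> 0 \<le> sum_mset K"
  by (induction K) auto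

lemma card_subsums_small_multiples:
  assumes "small_multiples n M b K"
  shows "int (card (subsums n M)) = sum_mset K + 1"
proof -
  have "card (subsums n M) = card {0..sum_mset K}"
    using assms card_image[OF small_multiples_inj_on] unfolding small_multiples_def by auto
  moreover have "0 \<le> sum_mset K" using assms sum_mset_nonneg_int unfolding small_multiples_def by blast
  ultimately show ?thesis by simp
qed

lemma subsums_replicate_mset:
  "subsums n (replicate_mset l a) = (\<lambda>j. j * a mod n) ` {0..int l}"
proof (intro equalityI subsetI)
  fix t assume "t \<in> subsums n (replicate_mset l a)"
  then obtain A where A: "A \<subseteq># replicate_mset l a" "t = sum_mset A mod n"
    by (auto simp: subsums_def)
  then obtain m where "m \<le> l" "A = replicate_mset m a" by (meson msubseteq_replicate_msetE)
  then show "t \<in> (\<lambda>j. j * a mod n) ` {0..int l}"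
    using A(2) by (auto intro!: image_eqI[of _ _ "int m"])
next
  fix t assume "t \<in> (\<lambda>j. j * a mod n) ` {0..int l}"
  then obtain j where j: "0 \<le> j" "j \<le> int l" "t = j * a mod n" by auto
  then have "t = sum_mset (replicate_mset (nat j) a) mod n" by simp
  moreover have "replicate_mset (nat j) a \<subseteq># replicate_mset l a"
    using j by (simp add: subseteq_mset_def)
  ultimately show "t \<in> subsums n (replicate_mset l a)" unfolding subsums_def by blast
qed

lemma small_multiples_replicate_mset:
  assumes "zero_sum_free n (replicate_mset l a)" "a mod n = a"
  shows "small_multiples n (replicate_mset l a) a (replicate_mset l 1)"
  unfolding small_multiples_def
proof (intro conjI ballI)
  fix j assume "j \<in> {1..sum_mset (replicate_mset l (1::int))}"
  then have j: "1 \<le> j" "j \<le> int l" by auto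
  have "sum_mset (replicate_mset (nat j) a) mod n \<noteq> 0"
    by (rule zero_sum_freeD[OF assms(1)]) (use j in \<open>simp_all add: subseteq_mset_def\<close>)
  then show "j * a mod n \<noteq> 0" using j by simp
next
  show "replicate_mset l a = image_mset (\<lambda>k. k * a mod n) (replicate_mset l 1)"
    using assms(2) by simp
  show "subsums n (replicate_mset l a) = (\<lambda>j. j * a mod n) ` {0..sum_mset (replicate_mset l 1)}"
    by (simp add: subsums_replicate_mset)
next
  show "1 \<le> k" if "k \<in># replicate_mset l 1" for k :: int
    using that by (metis in_replicate_mset order_refl)
qed

text \<open>
  Let \<open>X\<close> be the total coefficient of \<open>M\<close>. If the two translates \<open>[0, X] b\<close> and
  \<open>a + [0, X] b\<close> are disjoint, then the number of subsums doubles, which exceeds the bound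
  because \<open>X \<ge> |M|\<close>. If they meet, then \<open>a = m b\<close> with \<open>|m| \<le> X\<close>, and the zero-free
  property excludes both \<open>m \<le> 0\<close> and a return of \<open>[0, X + m] b\<close> to zero.
\<close>

lemma small_multiples_add_mset:
  assumes M: "small_multiples n M b K"
    and zf: "zero_sum_free n (add_mset a M)" and a: "a mod n = a"
    and few: "card (subsums n (add_mset a M)) + 1 \<le> 2 * size (add_mset a M)"
  shows "\<exists>m. small_multiples n (add_mset a M) b (add_mset m K)"
proof -
  define X where "X = sum_mset K"
  define f where "f = (\<lambda>j. j * b mod n)"
  define g where "g = (\<lambda>s. (s + a) mod n)"
  have K1: "\<forall>k\<in>#K. 1 \<le> k" and MK: "M = image_mset f K" and S: "subsums n M = f ` {0..X}"
    and ne: "\<And>j. 1 \<le> j \<Longrightarrow> j \<le> X \<Longrightarrow> j * b mod n \<noteq> 0"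
    using M unfolding small_multiples_def X_def f_def by auto
  have sizeX: "int (size M) \<le> X"
  proof -
    have "int (size K) \<le> sum_mset K" using K1 by (induction K) auto
    then show ?thesis by (simp add: MK X_def)
  qed
  have inj: "inj_on f {0..X}" unfolding f_def by (rule small_multiples_inj_on) (use ne in auto)
  have cS: "int (card (subsums n M)) = X + 1"
    using card_subsums_small_multiples[OF M] by (simp add: X_def)
  have S': "subsums n (add_mset a M) = subsums n M \<union> g ` subsums n M"
    unfolding g_def by (rule subsums_add_mset)
  have not0: "(j * b + a) mod n \<noteq> 0" if "0 \<le> j" "j \<le> X" for j
  proof -
    have "f j \<in> subsums n M" using that S by auto
    from zero_sum_free_add_mset_not_zero[OF zf this] show ?thesis
      by (simp add: f_def mod_simps)
  qed
  have "subsums n M \<inter> g ` subsums n M \<noteq> {}"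
  proof
    assume "subsums n M \<inter> g ` subsums n M = {}"
    then have "card (subsums n (add_mset a M)) = card (subsums n M) + card (g ` subsums n M)"
      unfolding S' by (intro card_Un_disjoint) auto
    moreover have "inj_on g (subsums n M)"
    proof (rule inj_onI)
      fix s t assume "s \<in> subsums n M" "t \<in> subsums n M" "g s = g t"
      then have "s mod n = t mod n" unfolding g_def by (simp add: mod_eq_dvd_iff)
      moreover have "s mod n = s" "t mod n = t"
        using \<open>s \<in> _\<close> \<open>t \<in> _\<close> by (auto simp: subsums_def)
      ultimately show "s = t" by simp
    qed
    ultimately show False using cS few sizeX by (simp add: card_image)
  qed
  then obtain i j where ij: "0 \<le> i" "i \<le> X" "0 \<le> j" "j \<le> X" "f i = g (f j)"
    unfolding S by auto
  define m where "m = i - j"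
  have "(i * b) mod n = (j * b + a) mod n" using ij(5) by (simp add: f_def g_def mod_simps)
  then have "n dvd i * b - (j * b + a)" by (simp add: mod_eq_dvd_iff)
  then have dvd: "n dvd m * b - a" by (simp add: m_def algebra_simps)
  then have am: "a = f m" using a unfolding f_def by (metis mod_eq_dvd_iff)
  have shift: "(h * b + a) mod n = f (h + m)" for h
    using dvd by (simp add: f_def mod_eq_dvd_iff algebra_simps dvd_diff_commute)
  have m1: "1 \<le> m"
  proof (rule ccontr)
    assume "\<not> 1 \<le> m"
    then have "(- m * b + a) mod n \<noteq> 0" using ij by (intro not0) (auto simp: m_def)
    then show False by (simp only: shift) (simp add: f_def)
  qed
  have mX: "m \<le> X" using ij by (simp add: m_def)
  have Sf: "subsums n (add_mset a M) = f ` {0..X + m}"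
  proof -
    have "g ` f ` {0..X} = f ` (\<lambda>h. h + m) ` {0..X}"
      by (simp add: image_image g_def f_def mod_simps shift[unfolded f_def] del: image_add_atLeastAtMost')
    also have "\<dots> = f ` {m..X + m}" by (simp add: add.commute)
    finally have "subsums n (add_mset a M) = f ` ({0..X} \<union> {m..X + m})"
      unfolding S' S by (simp add: image_Un)
    also have "{0..X} \<union> {m..X + m} = {0..X + m}" using m1 mX ij by auto
    finally show ?thesis .
  qed
  have "j * b mod n \<noteq> 0" if "1 \<le> j" "j \<le> X + m" for j
  proof (cases "j \<le> X")
    case True
    then show ?thesis by (rule ne[OF that(1)])
  next
    case False
    then have "((j - m) * b + a) mod n \<noteq> 0" using that m1 mX by (intro not0) auto
    then show ?thesis by (simp only: shift) (simp add: f_def)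
  qed
  then have "small_multiples n (add_mset a M) b (add_mset m K)"
    unfolding small_multiples_def
    using K1 MK Sf am m1 unfolding f_def X_def by (auto simp: add.commute)
  then show ?thesis ..
qed

text \<open>
  If every deletion of a single term removes only the total sum \<open>\<sigma>\<close> from the set \<open>S\<close> of
  subsums, then translation by each term \<open>a\<close> maps \<open>S - {\<sigma>}\<close> onto \<open>S - {0}\<close>. For two different
  terms \<open>a\<close> and \<open>a'\<close> this gives \<open>a \<in> S - {0} = (S - {\<sigma>}) + a'\<close>, so \<open>a - a'\<close> is a nonzero
  element of \<open>S\<close>; hence it lies in \<open>(S - {\<sigma>}) + a\<close>, and \<open>- a'\<close> is a subsum avoiding \<open>a'\<close>,
  which is impossible.
\<close>

lemma all_equal_if_only_total_lost:
  assumes zf: "zero_sum_free n M" and red: "\<forall>a\<in>#M. a mod n = a"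
    and lost: "\<forall>a\<in>#M. subsums n (M - {#a#}) = T"
    and one: "\<forall>a\<in>#M. card (subsums n M) = card (subsums n (M - {#a#})) + 1"
    and a: "a \<in># M" and a': "a' \<in># M"
  shows "a = a'"
proof (rule ccontr)
  assume neq: "a \<noteq> a'"
  define S where "S = subsums n M"
  have shift: "(\<lambda>s. (s + c) mod n) ` T = S - {0}" if c: "c \<in># M" for c
  proof (rule card_subset_eq)
    define N where "N = M - {#c#}"
    have M: "add_mset c N = M" using c by (simp add: N_def)
    have T: "subsums n N = T" using lost c by (simp add: N_def)
    have "(\<lambda>s. (s + c) mod n) ` T \<subseteq> S"
      using subsums_add_mset[of n c N] unfolding M T S_def by simp
    moreover have "(s + c) mod n \<noteq> 0" if "s \<in> T" for s
      using zero_sum_free_add_mset_not_zero[of n c N s] zf that unfolding M T .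
    then have "0 \<notin> (\<lambda>s. (s + c) mod n) ` T" by fastforce
    ultimately show "(\<lambda>s. (s + c) mod n) ` T \<subseteq> S - {0}" by blast
    have "inj_on (\<lambda>s. (s + c) mod n) T"
    proof (rule inj_onI)
      fix s t assume st: "s \<in> T" "t \<in> T" "(s + c) mod n = (t + c) mod n"
      then have "s mod n = t mod n" by (simp add: mod_eq_dvd_iff)
      moreover have "s mod n = s" "t mod n = t" using st unfolding T[symmetric] by (auto simp: subsums_def)
      ultimately show "s = t" by simp
    qed
    then have "card ((\<lambda>s. (s + c) mod n) ` T) = card T" by (rule card_image)
    also have "\<dots> = card (S - {0})"
      using one c T zero_in_subsums[of n M] by (simp add: S_def N_def)
    finally show "card ((\<lambda>s. (s + c) mod n) ` T) = card (S - {0})" .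
  qed (simp add: S_def)
  have aS: "a \<in> S - {0}"
  proof -
    have "subsums n (M - {#a#}) = T" using lost a by blast
    then have "0 \<in> T" using zero_in_subsums by metis
    then have "(0 + a) mod n \<in> (\<lambda>s. (s + a) mod n) ` T" by (rule imageI)
    then have "(0 + a) mod n \<in> S - {0}" unfolding shift[OF a] .
    moreover have "a mod n = a" using red a by blast
    ultimately show ?thesis by simp
  qed
  then have "a \<in> (\<lambda>s. (s + a') mod n) ` T" unfolding shift[OF a'] .
  then obtain t where t: "t \<in> T" "a = (t + a') mod n" by blast
  have "t \<in> S"
  proof -
    have "subsums n (M - {#a#}) = T" using lost a by blast
    then show ?thesis using t(1) subsums_mono[of "M - {#a#}" M n] unfolding S_def by auto
  qed
  moreover have "t \<noteq> 0"
  proof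
    assume "t = 0"
    then have "a = a' mod n" using t(2) by simp
    moreover have "a' mod n = a'" using red a' by blast
    ultimately show False using neq by simp
  qed
  ultimately have "t \<in> (\<lambda>s. (s + a) mod n) ` T" unfolding shift[OF a] by blast
  then obtain u where u: "u \<in> T" "t = (u + a) mod n" by blast
  have "(u + a') mod n = 0"
  proof -
    have "a mod n = (t + a') mod n" by (subst t(2)) simp
    also have "\<dots> = (u + a + a') mod n" unfolding u(2) by (simp add: mod_simps)
    finally have "a mod n = (u + a + a') mod n" .
    then have "n dvd - (u + a')" by (simp add: mod_eq_dvd_iff)
    then show ?thesis by (simp only: dvd_minus_iff dvd_imp_mod_0)
  qed
  moreover have "(u + a') mod n \<in> (\<lambda>s. (s + a') mod n) ` T" using u(1) by (rule imageI)
  then have "(u + a') mod n \<in> S - {0}" unfolding shift[OF a'] .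
  ultimately show False by simp
qed

text \<open>
  The bound is sharp: for a generic \<open>c\<close> the sequence of \<open>\<ell> - 1\<close> terms \<open>b\<close> and one term \<open>c\<close> has
  \<open>2 \<ell>\<close> subsums. In the induction step, a deletion that costs at least two subsums preserves
  the bound. Otherwise, since each deletion loses the total sum \<open>\<sigma>\<close>, it loses nothing else.
\<close>

theorem small_multiples_if_few_subsums:
  assumes "zero_sum_free n M" "\<forall>a\<in>#M. a mod n = a"
    and "card (subsums n M) + 1 \<le> 2 * size M"
  shows "\<exists>b K. small_multiples n M b K"
  using assms
proof (induction "size M" arbitrary: M rule: less_induct)
  case less
  note zf = less.prems(1) and red = less.prems(2) and few = less.prems(3)
  show ?case
  proof (cases "\<exists>a\<in>#M. card (subsums n (M - {#a#})) + 1 \<le> 2 * size (M - {#a#})")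
    case True
    then obtain a N where M: "M = add_mset a N" and N: "card (subsums n N) + 1 \<le> 2 * size N"
      by (metis add_mset_remove_trivial insert_DiffM)
    have "zero_sum_free n N" using zf M zero_sum_free_subset[of n M N] by simp
    then obtain b K where "small_multiples n N b K"
      using less.hyps[of N] N M red by auto
    then show ?thesis using small_multiples_add_mset[of n N b K a] zf red few M by auto
  next
    case False
    define \<sigma> where "\<sigma> = sum_mset M mod n"
    have \<sigma>S: "\<sigma> \<in> subsums n M" by (auto simp: \<sigma>_def subsums_def)
    have del: "subsums n (M - {#a#}) = subsums n M - {\<sigma>} \<and>
        card (subsums n M) = card (subsums n (M - {#a#})) + 1" if a: "a \<in># M" for a
    proof -
      have sub: "subsums n (M - {#a#}) \<subseteq> subsums n M - {\<sigma>}"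
        using subsums_mono[of "M - {#a#}" M n] total_notin_subsums[of n a "M - {#a#}"] zf a
        by (auto simp: \<sigma>_def)
      have "card (subsums n (M - {#a#})) + 1 > 2 * size (M - {#a#})" using False a by force
      moreover have "size M = size (M - {#a#}) + 1"
        using a by (metis Suc_eq_plus1 insert_DiffM size_add_mset)
      moreover have c: "card (subsums n M) = card (subsums n M - {\<sigma>}) + 1"
        using \<sigma>S by (metis Suc_eq_plus1 card_Suc_Diff1 finite_subsums)
      ultimately have "card (subsums n M - {\<sigma>}) \<le> card (subsums n (M - {#a#}))"
        using few by linarith
      then have "subsums n (M - {#a#}) = subsums n M - {\<sigma>}"
        using sub by (meson card_seteq finite_Diff finite_subsums)
      then show ?thesis using c by simp
    qed
    have "M \<noteq> {#}" using few by auto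
    then obtain a where a: "a \<in># M" by blast
    have "\<forall>c\<in>#M. c = a"
      using all_equal_if_only_total_lost[OF zf red, of "subsums n M - {\<sigma>}"] del a by blast
    then have "M = replicate_mset (size M) a"
      by (intro set_mset_subset_singletonD) auto
    moreover have "a mod n = a" using red a by blast
    ultimately show ?thesis
      using small_multiples_replicate_mset[of n "size M" a] zf by metis
  qed
qed

section \<open>Multiplicities\<close>

lemma long_zero_sum_free_multiples:
  assumes n: "0 < n" and zf: "zero_sum_free n M" and red: "set_mset M \<subseteq> {0..<n}"
    and long: "n < 2 * int (size M)"
  obtains b K where "M = image_mset (\<lambda>k. k * b mod n) K" "\<forall>k\<in>#K. (1::int) \<le> k" "sum_mset K < n"
proof -
  have "subsums n M \<subseteq> {0..<n}" using n by (auto simp: subsums_def)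
  then have c: "card (subsums n M) \<le> nat n"
    using card_mono[of "{0..<n}" "subsums n M"] by simp
  have "\<forall>a\<in>#M. a mod n = a" using red by auto
  then obtain b K where K: "small_multiples n M b K"
  proof -
    have "card (subsums n M) + 1 \<le> 2 * size M" using c long n by linarith
    then show thesis using small_multiples_if_few_subsums[OF zf \<open>\<forall>a\<in>#M. a mod n = a\<close>] that by blast
  qed
  then have "sum_mset K < n" using card_subsums_small_multiples[OF K] c n by linarith
  then show thesis using that[of b K] K unfolding small_multiples_def by simp
qed

text \<open>
  All coefficients other than one are at least two, and all coefficients other than one and
  two are at least three.
\<close>

lemma sum_mset_ge_ones_twos:
  assumes "\<forall>k\<in>#K. (1::int) \<le> k"
  shows "sum_mset K \<ge> 2 * int (size K) - int (count K 1)"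
    and "sum_mset K \<ge> 3 * int (size K) - 2 * int (count K 1) - int (count K 2)"
  using assms by (induction K) (auto split: if_splits)

lemma count_le_count_image_mset: "count K k \<le> count (image_mset f K) (f k)"
  by (induction K) auto

theorem zero_sum_free_multiplicity:
  assumes n: "0 < n" and zf: "zero_sum_free n M" and red: "set_mset M \<subseteq> {0..<n}"
    and long: "n < 2 * int (size M)"
  shows "\<exists>x. int (count M x) \<ge> 2 * int (size M) - n + 1"
    and "\<exists>x. int (count M x) \<ge> int (size M) - (n - 1) div 3"
proof -
  obtain b K where M: "M = image_mset (\<lambda>k. k * b mod n) K" and K: "\<forall>k\<in>#K. (1::int) \<le> k"
    and s: "sum_mset K < n"
    using long_zero_sum_free_multiples[OF assms] .
  have cnt: "int (count K k) \<le> int (count M (k * b mod n))" for k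
    unfolding M using count_le_count_image_mset[of K k "\<lambda>k. k * b mod n"] by simp
  have size: "size K = size M" by (simp add: M)
  show "\<exists>x. int (count M x) \<ge> 2 * int (size M) - n + 1"
    using sum_mset_ge_ones_twos(1)[OF K] cnt[of 1] s size
    by (intro exI[of _ "1 * b mod n"]) linarith
  have "int (count K 1) \<ge> int (size M) - (n - 1) div 3 \<or>
        int (count K 2) \<ge> int (size M) - (n - 1) div 3"
    using sum_mset_ge_ones_twos(2)[OF K] s size by linarith
  then show "\<exists>x. int (count M x) \<ge> int (size M) - (n - 1) div 3"
    using cnt[of 1] cnt[of 2] by (meson order_trans)
qed

section \<open>Sequences in the group of integers modulo n\<close>

lemma finprod_integer_mod_group:
  assumes n: "0 < n" and I: "finite I" and f: "\<forall>i\<in>I. f i \<in> {0..<n}"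
  shows "finprod (integer_mod_group (nat n)) f I = (\<Sum>i\<in>I. f i) mod n"
proof -
  interpret comm_group "integer_mod_group (nat n)" by (rule abelian_integer_mod_group)
  have carrier: "carrier (integer_mod_group (nat n)) = {0..<n}"
    using n by (simp add: carrier_integer_mod_group)
  show ?thesis using I f
  proof (induction I rule: finite_induct)
    case (insert i I)
    have "finprod (integer_mod_group (nat n)) f (insert i I) =
        f i \<otimes>\<^bsub>integer_mod_group (nat n)\<^esub> finprod (integer_mod_group (nat n)) f I"
      using insert by (intro finprod_insert) (auto simp: carrier)
    then show ?case using insert n by (simp add: mod_simps)
  qed simp
qed

lemma submultiset_of_mset_indices:
  assumes "A \<subseteq># mset xs"
  obtains I where "I \<subseteq> {..<length xs}" "A = image_mset ((!) xs) (mset_set I)"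
proof -
  have "mset xs = image_mset ((!) xs) (mset_set {..<length xs})"
    by (metis map_nth mset_map mset_upt atLeast0LessThan)
  then obtain B C where BC: "mset_set {..<length xs} = B + C" "A = image_mset ((!) xs) B"
    using assms by (metis image_mset_eq_plusD mset_subset_eq_exists_conv)
  have "B = mset_set (set_mset B)"
  proof (rule multiset_eqI)
    fix i
    have "count B i \<le> count (mset_set {..<length xs}) i" using BC(1) by simp
    also have "\<dots> \<le> 1" by (simp add: count_mset_set')
    finally show "count B i = count (mset_set (set_mset B)) i"
      by (cases "count B i") (auto simp: count_mset_set' not_in_iff simp flip: count_greater_zero_iff)
  qed
  moreover have "set_mset B \<subseteq> {..<length xs}"
    using BC(1) by (metis finite_lessThan finite_set_mset_mset_set set_mset_union Un_upper1)
  ultimately show thesis using that BC(2) by metis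
qed

lemma zero_free_imp_zero_sum_free:
  assumes n: "0 < n" and zf: "zero_free (integer_mod_group (nat n)) xs"
  shows "zero_sum_free n (mset xs)" and "set xs \<subseteq> {0..<n}"
proof -
  show sub: "set xs \<subseteq> {0..<n}"
    using zf n by (simp add: zero_free_def carrier_integer_mod_group)
  show "zero_sum_free n (mset xs)"
    unfolding zero_sum_free_def
  proof (intro allI impI, elim conjE)
    fix A assume A: "A \<subseteq># mset xs" "A \<noteq> {#}"
    obtain I where I: "I \<subseteq> {..<length xs}" "A = image_mset ((!) xs) (mset_set I)"
      using submultiset_of_mset_indices[OF A(1)] .
    have fin: "finite I" using I(1) finite_subset by blast
    have "I \<noteq> {}" using A(2) I(2) by auto
    then have "finprod (integer_mod_group (nat n)) ((!) xs) I \<noteq> 0"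
      using zf I(1) by (simp add: zero_free_def)
    moreover have "finprod (integer_mod_group (nat n)) ((!) xs) I = (\<Sum>i\<in>I. xs ! i) mod n"
      using I(1) sub n fin by (intro finprod_integer_mod_group) (auto simp: subset_iff)
    moreover have "(\<Sum>i\<in>I. xs ! i) = sum_mset A" by (simp add: I(2) sum_unfold_sum_mset)
    ultimately show "sum_mset A mod n \<noteq> 0" by simp
  qed
qed

lemma zero_free_if_sum_list_less:
  assumes n: "0 < n" and pos: "\<forall>x\<in>set xs. 1 \<le> x" and less: "sum_list xs < n"
  shows "zero_free (integer_mod_group (nat n)) xs"
proof -
  have pos_nth: "0 < xs ! i" if "i < length xs" for i
    using pos nth_mem[OF that] by fastforce
  have part: "(\<Sum>i\<in>I. xs ! i) < n" if "I \<subseteq> {..<length xs}" for I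
  proof -
    have "(\<Sum>i\<in>I. xs ! i) \<le> (\<Sum>i<length xs. xs ! i)"
      using that pos_nth by (intro sum_mono2) (auto simp: less_imp_le)
    also have "\<dots> = sum_list xs" by (simp add: sum_list_sum_nth atLeast0LessThan)
    finally show ?thesis using less by simp
  qed
  have range: "xs ! i \<in> {0..<n}" if "i < length xs" for i
    using part[of "{i}"] that pos_nth[OF that] by simp
  show ?thesis
    unfolding zero_free_def
  proof (intro conjI allI impI)
    show "set xs \<subseteq> carrier (integer_mod_group (nat n))"
      using range n by (auto simp: carrier_integer_mod_group set_conv_nth)
    fix I assume I: "I \<subseteq> {..<length xs} \<and> I \<noteq> {}"
    then have fin: "finite I" using finite_subset by blast
    have "finprod (integer_mod_group (nat n)) ((!) xs) I = (\<Sum>i\<in>I. xs ! i) mod n"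
      using I range n fin by (intro finprod_integer_mod_group) auto
    moreover have "0 < (\<Sum>i\<in>I. xs ! i)"
      using I fin pos_nth by (intro sum_pos) auto
    ultimately show "finprod (integer_mod_group (nat n)) ((!) xs) I \<noteq> \<one>\<^bsub>integer_mod_group (nat n)\<^esub>"
      using part[of I] I by simp
  qed
qed

lemma max_multiplicity_ones_twos_threes:
  assumes "1 \<le> i" "j \<le> i" "k \<le> i"
  shows "max_multiplicity (replicate i 1 @ replicate j 2 @ replicate k (3::int)) = i"
proof -
  let ?xs = "replicate i 1 @ replicate j 2 @ replicate k (3::int)"
  have count: "count_list (replicate m y) x = (if x = y then m else 0)" for m and x y :: int
    by (induction m) auto
  show ?thesis
    unfolding max_multiplicity_def
  proof (rule Max_eqI)
    show "y \<le> i" if "y \<in> count_list ?xs ` set ?xs" for y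
      using that assms by (auto simp: count split: if_splits)
    show "i \<in> count_list ?xs ` set ?xs"
      using assms by (intro image_eqI[of _ _ 1]) (auto simp: count)
  qed simp
qed

text \<open>The witness has \<open>i\<close> ones, \<open>j\<close> twos and \<open>k\<close> threes.\<close>

lemma zero_free_with_max_multiplicity:
  fixes n i j k :: int
  assumes "1 \<le> i" "0 \<le> j" "j \<le> i" "0 \<le> k" "k \<le> i" "i + 2 * j + 3 * k < n"
  shows "\<exists>xs. zero_free (integer_mod_group (nat n)) xs \<and> int (length xs) = i + j + k \<and>
              int (max_multiplicity xs) = i"
proof -
  let ?xs = "replicate (nat i) 1 @ replicate (nat j) 2 @ replicate (nat k) (3::int)"
  have "zero_free (integer_mod_group (nat n)) ?xs"
    using assms by (intro zero_free_if_sum_list_less) (auto simp: sum_list_replicate)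
  moreover have "max_multiplicity ?xs = nat i"
    using assms by (intro max_multiplicity_ones_twos_threes) auto
  ultimately show ?thesis using assms by (intro exI[of _ ?xs]) auto
qed

theorem proposition11:
  fixes n l :: int
  assumes "real_of_int n / 2 < real_of_int l" and "l < n"
  shows "((2 * real_of_int n - 2) / 3 \<le> real_of_int l \<longrightarrow>
            (\<forall>xs. zero_free (integer_mod_group (nat n)) xs \<and> int (length xs) = l \<longrightarrow>
                  (\<exists>x \<in> set xs. int (count_list xs x) \<ge> 2 * l - n + 1)) \<and>
            (\<exists>xs. zero_free (integer_mod_group (nat n)) xs \<and> int (length xs) = l \<and>
                  int (max_multiplicity xs) = 2 * l - n + 1)) \<and>
         (real_of_int l \<le> (2 * real_of_int n - 2) / 3 \<longrightarrow>
            (\<forall>xs. zero_free (integer_mod_group (nat n)) xs \<and> int (length xs) = l \<longrightarrow>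
                  (\<exists>x \<in> set xs. int (count_list xs x) \<ge> l - \<lfloor>(real_of_int n - 1) / 3\<rfloor>)) \<and>
            (\<exists>xs. zero_free (integer_mod_group (nat n)) xs \<and> int (length xs) = l \<and>
                  int (max_multiplicity xs) = l - \<lfloor>(real_of_int n - 1) / 3\<rfloor>))"
proof -
  define q where "q = (n - 1) div 3"
  have fl: "\<lfloor>(real_of_int n - 1) / 3\<rfloor> = q"
    using floor_divide_of_int_eq[of "n - 1" 3, where 'a = real] by (simp add: q_def)
  have l: "n < 2 * l" "l < n" using assms by linarith+
  then have n: "0 < n" by linarith
  have lower: "(\<exists>x\<in>set xs. int (count_list xs x) \<ge> 2 * l - n + 1) \<and>
               (\<exists>x\<in>set xs. int (count_list xs x) \<ge> l - q)"
    if xs: "zero_free (integer_mod_group (nat n)) xs" "int (length xs) = l" for xs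
  proof -
    have *: "\<exists>x\<in>set xs. int (count_list xs x) \<ge> c"
      if "\<exists>x. int (count (mset xs) x) \<ge> c" and "1 \<le> c" for c
    proof -
      from \<open>\<exists>x. int (count (mset xs) x) \<ge> c\<close> obtain x where x: "int (count (mset xs) x) \<ge> c" ..
      then have "count (mset xs) x \<noteq> 0" using \<open>1 \<le> c\<close> by linarith
      then have "x \<in> set xs" by simp
      then show ?thesis using x by (auto simp: count_mset)
    qed
    have q1: "1 \<le> l - q" using l unfolding q_def by linarith
    have "set_mset (mset xs) \<subseteq> {0..<n}" "n < 2 * int (size (mset xs))"
      using zero_free_imp_zero_sum_free(2)[OF n xs(1)] xs(2) l by auto
    note mult = zero_sum_free_multiplicity[OF n zero_free_imp_zero_sum_free(1)[OF n xs(1)] this]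
    show ?thesis
      using *[of "2 * l - n + 1"] *[of "l - q"] mult xs(2) l q1 by (simp add: q_def)
  qed
  have exA: "\<exists>xs. zero_free (integer_mod_group (nat n)) xs \<and> int (length xs) = l \<and>
                  int (max_multiplicity xs) = 2 * l - n + 1"
    if "(2 * real_of_int n - 2) / 3 \<le> real_of_int l"
  proof -
    have "real_of_int (2 * n - 2) \<le> real_of_int (3 * l)" using that by (simp add: field_simps)
    then have "2 * n - 2 \<le> 3 * l" by (simp only: of_int_le_iff)
    (* The ones and twos are balanced so that the total is n - 1. *)
    then show ?thesis
      using zero_free_with_max_multiplicity[of "2 * l - n + 1" "n - 1 - l" 0 n] l by auto
  qed
  have exB: "\<exists>xs. zero_free (integer_mod_group (nat n)) xs \<and> int (length xs) = l \<and>
                  int (max_multiplicity xs) = l - q"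
    if "real_of_int l \<le> (2 * real_of_int n - 2) / 3"
  proof -
    have "real_of_int (3 * l) \<le> real_of_int (2 * n - 2)" using that by (simp add: field_simps)
    then have up: "3 * l \<le> 2 * n - 2" by (simp only: of_int_le_iff)
    have q: "3 * q \<le> n - 1" "n - 1 \<le> 3 * q + 2" unfolding q_def by linarith+
    show ?thesis
    proof (cases "l \<le> 2 * q")
      case True
      (* Equally many ones and twos, filled up with threes: the total is 3 q. *)
      then show ?thesis
        using zero_free_with_max_multiplicity[of "l - q" "l - q" "2 * q - l" n] l q by auto
    next
      case False
      (* The range of l leaves only l = 2 q + 1 and n - 1 = 3 q + 2, with l - q = q + 1;
         the total is then 3 q + 1. *)
      then show ?thesis
        using zero_free_with_max_multiplicity[of "l - q" q 0 n] l q up by auto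
    qed
  qed
  show ?thesis unfolding fl using lower exA exB by blast
qed

end
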